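(* For $\delta>0$ let $$\boldsymbol{\alpha}(x,y)=\frac{y-x}{|y-x|}\,\mathcal{X}(y\in B_\delta(x)),\qquad x,y\in\mathbb{R}^3,$$ where $B_\delta(x)$ is the Euclidean ball of radius $\delta$ centred at $x$ and $\mathcal{X}$ denotes the indicator function, and let $\kappa=\frac{75}{8\pi\delta^5}$. Then, for a vector field $\mathbf{w}=(w_1,w_2,w_3)$, as $\delta\to 0$, $$\kappa\,\mathcal{C}_{\boldsymbol{\alpha}}\big(\mathcal{C}_{\boldsymbol{\alpha}}^*\mathbf{w}\big)\to \nabla\times(\nabla\times\mathbf{w})-\Delta\mathbf{w}.$$ In conclusion, the convergence of the scaled nonlocal operator $\kappa\,\mathcal{C}_{\boldsymbol{\alpha}}(\mathcal{C}_{\boldsymbol{\alpha}}^*\mathbf{w})$ to its classical counterpart $\nabla\times(\nabla\times\mathbf{w})$ holds only on the space of harmonic functions $\mathbf{w}$.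
   Context: For an antisymmetric kernel $\boldsymbol{\alpha}:\mathbb{R}^3\times\mathbb{R}^3\to\mathbb{R}^3$ (i.e. $\boldsymbol{\alpha}(x,y)=-\boldsymbol{\alpha}(y,x)$), the nonlocal curl of a two-point vector function $\mathbf{u}(x,y)$ is $$(\mathcal{C}_{\boldsymbol{\alpha}}\mathbf{u})(x)=\int_{\mathbb{R}^3}\boldsymbol{\alpha}(x,y)\times\big(\mathbf{u}(x,y)+\mathbf{u}(y,x)\big)\,dy,$$ and its adjoint acts on a one-point vector field $\mathbf{w}$ by $$(\mathcal{C}_{\boldsymbol{\alpha}}^*\mathbf{w})(x,y)=\boldsymbol{\alpha}(x,y)\times(\mathbf{w}(y)-\mathbf{w}(x)).$$ $\Delta\mathbf{w}$ is the vector (componentwise) Laplacian. *)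

theory Defs
  imports "HOL-Analysis.Analysis"
begin

unbundle cross3_syntax

definition partial_deriv :: "3 \<Rightarrow> (real^3 \<Rightarrow> real) \<Rightarrow> real^3 \<Rightarrow> real" where
  "partial_deriv j f x = deriv (\<lambda>t. f (x + t *\<^sub>R axis j 1)) 0"

definition curl :: "(real^3 \<Rightarrow> real^3) \<Rightarrow> real^3 \<Rightarrow> real^3" where
  "curl w x = vector
     [partial_deriv 2 (\<lambda>y. w y $ 3) x - partial_deriv 3 (\<lambda>y. w y $ 2) x,
      partial_deriv 3 (\<lambda>y. w y $ 1) x - partial_deriv 1 (\<lambda>y. w y $ 3) x,
      partial_deriv 1 (\<lambda>y. w y $ 2) x - partial_deriv 2 (\<lambda>y. w y $ 1) x]"

definition laplacian :: "(real^3 \<Rightarrow> real) \<Rightarrow> real^3 \<Rightarrow> real" where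
  "laplacian f x = (\<Sum>j\<in>UNIV. partial_deriv j (partial_deriv j f) x)"

definition vector_laplacian :: "(real^3 \<Rightarrow> real^3) \<Rightarrow> real^3 \<Rightarrow> real^3" where
  "vector_laplacian w x = (\<chi> i. laplacian (\<lambda>y. w y $ i) x)"

definition C2 :: "(real^3 \<Rightarrow> real^3) \<Rightarrow> bool" where
  "C2 w \<longleftrightarrow>
     (\<exists>(w' :: real^3 \<Rightarrow> (real^3) \<Rightarrow>\<^sub>L (real^3))
       (w'' :: real^3 \<Rightarrow> (real^3) \<Rightarrow>\<^sub>L ((real^3) \<Rightarrow>\<^sub>L (real^3))).
       (\<forall>x. (w has_derivative blinfun_apply (w' x)) (at x)) \<and>
       (\<forall>x. (w' has_derivative blinfun_apply (w'' x)) (at x)) \<and>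
       continuous_on UNIV w'')"

definition harmonic :: "(real^3 \<Rightarrow> real^3) \<Rightarrow> bool" where
  "harmonic w \<longleftrightarrow> C2 w \<and> (\<forall>x. vector_laplacian w x = 0)"

text \<open>The nonlocal curl with kernel \<open>\<alpha>\<close> acts on two-point vector functions; its adjoint maps
  one-point vector fields to two-point vector functions. The kernel is meant to be antisymmetric.\<close>

definition nonlocal_curl ::
  "(real^3 \<Rightarrow> real^3 \<Rightarrow> real^3) \<Rightarrow> (real^3 \<Rightarrow> real^3 \<Rightarrow> real^3) \<Rightarrow> real^3 \<Rightarrow> real^3" where
  "nonlocal_curl \<alpha> u x = (LINT y|lborel. \<alpha> x y \<times> (u x y + u y x))"

definition nonlocal_curl_adj ::
  "(real^3 \<Rightarrow> real^3 \<Rightarrow> real^3) \<Rightarrow> (real^3 \<Rightarrow> real^3) \<Rightarrow> real^3 \<Rightarrow> real^3 \<Rightarrow> real^3" where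
  "nonlocal_curl_adj \<alpha> w x y = \<alpha> x y \<times> (w y - w x)"

text \<open>At \<open>y = x\<close> the quotient is zero by the convention for division by zero; this affects
  only a null set.\<close>

definition ball_kernel :: "real \<Rightarrow> real^3 \<Rightarrow> real^3 \<Rightarrow> real^3" where
  "ball_kernel \<delta> x y = indicat_real (ball x \<delta>) y *\<^sub>R ((y - x) /\<^sub>R norm (y - x))"

lemma ball_kernel_antisym: "ball_kernel \<delta> x y = - ball_kernel \<delta> y x"
  by (auto simp: ball_kernel_def indicator_def dist_commute norm_minus_commute algebra_simps)

definition kappa :: "real \<Rightarrow> real" where
  "kappa \<delta> = 75 / (8 * pi * \<delta> ^ 5)"

end

(*
  Substituting z = y - x and using the antisymmetry of the kernel, the nonlocal operator becomes
  twice the integral over the ball |z| < delta of n \<times> (n \<times> (w(x+z) - w(x))), with n = z/|z|.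
  In the second-order Taylor expansion of w at x the linear term integrates to zero by oddness,
  the remainder contributes o(delta^5), and the quadratic term is a combination of the moments
  of z_i z_j z_k z_l / |z|^2 and z_k z_l over the ball. Rotation invariance forces the fourth
  moment tensor to be a multiple of the isotropic tensor, and its trace, the integral of |z|^2,
  equals 4 pi delta^5 / 5. The factor kappa thus turns the quadratic term into
  grad div w - 2 Lap w, which is curl curl w - Lap w.
*)

theory Submission
  imports Defs
begin

subsection \<open>Moments of the ball\<close>

text \<open>A Borel measure with the right values on boxes is Lebesgue measure. The preimage of a
  box under \<open>T\<close> is its image under the inverse, which is again orthogonal and so
  preserves volume.\<close>

lemma distr_lborel_orthogonal_transformation:
  fixes T :: "real^'n::{finite,wellorder} \<Rightarrow> real^'n::_"
  assumes T: "orthogonal_transformation T"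
  shows "distr lborel borel T = lborel"
proof (rule lborel_eqI[symmetric])
  have [measurable]: "T \<in> borel_measurable borel"
    using T by (intro borel_measurable_continuous_onI linear_continuous_on)
      (simp add: linear_conv_bounded_linear[symmetric] orthogonal_transformation_linear)
  fix l u :: "real^'n::_"
  assume lu: "\<And>b. b \<in> Basis \<Longrightarrow> l \<bullet> b \<le> u \<bullet> b"
  have inv: "orthogonal_transformation (inv T)"
    using T by (rule orthogonal_transformation_inv)
  have vim: "T -` box l u = inv T ` box l u"
    using T by (simp add: bij_vimage_eq_inv_image orthogonal_transformation_bij)
  have meas: "inv T ` box l u \<in> lmeasurable"
    by (rule measurable_orthogonal_image[OF inv]) simp
  have "emeasure (distr lborel borel T) (box l u) = emeasure lborel (T -` box l u)"
    by (simp add: emeasure_distr)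
  \<comment> \<open>The facts on orthogonal images speak of the completed measure; on this Borel
    preimage both measures agree.\<close>
  also have "\<dots> = emeasure lebesgue (T -` box l u)"
    using measurable_sets_borel[of T borel "box l u"] by (simp add: emeasure_completion)
  also have "\<dots> = ennreal (measure lebesgue (inv T ` box l u))"
    unfolding vim by (rule emeasure_eq_measure2) (use meas in auto)
  also have "\<dots> = ennreal (measure lebesgue (box l u))"
    by (subst measure_orthogonal_image[OF inv]) auto
  also have "\<dots> = (\<Prod>b\<in>Basis. (u - l) \<bullet> b)"
    using lu by (simp add: measure_lborel_box_eq)
  finally show "emeasure (distr lborel borel T) (box l u) = (\<Prod>b\<in>Basis. (u - l) \<bullet> b)" .
qed simp

text \<open>Change of variables by \<open>T\<close>: the measure is invariant, and so is the
  indicator of a centred ball because \<open>T\<close> preserves norms.\<close>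

lemma set_integral_ball_orthogonal_transformation:
  fixes T :: "real^'n::{finite,wellorder} \<Rightarrow> real^'n::_"
    and f :: "real^'n::_ \<Rightarrow> 'b::{banach, second_countable_topology}"
  assumes T: "orthogonal_transformation T" and [measurable]: "f \<in> borel_measurable borel"
  shows "(LINT z:ball 0 r|lborel. f (T z)) = (LINT z:ball 0 r|lborel. f z)"
proof -
  have [measurable]: "T \<in> borel_measurable borel"
    using T by (intro borel_measurable_continuous_onI linear_continuous_on)
      (simp add: linear_conv_bounded_linear[symmetric] orthogonal_transformation_linear)
  have "(LINT z:ball 0 r|lborel. f z) =
      (LINT z|distr lborel borel T. indicat_real (ball 0 r) z *\<^sub>R f z)"
    by (simp add: set_lebesgue_integral_def distr_lborel_orthogonal_transformation[OF T])
  also have "\<dots> = (LINT z|lborel. indicat_real (ball 0 r) (T z) *\<^sub>R f (T z))"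
    by (rule integral_distr) (auto intro!: borel_measurable_scaleR borel_measurable_indicator assms)
  also have "\<dots> = (LINT z:ball 0 r|lborel. f (T z))"
    by (simp add: set_lebesgue_integral_def indicator_def orthogonal_transformation_norm[OF T])
  finally show ?thesis by simp
qed

text \<open>Negation is an orthogonal map, so the integral equals its own negative.\<close>

lemma set_integral_ball_odd:
  fixes f :: "real^'n::{finite,wellorder} \<Rightarrow> 'b::{banach, second_countable_topology}"
  assumes [measurable]: "f \<in> borel_measurable borel" and odd: "\<And>z. f (- z) = - f z"
  shows "(LINT z:ball 0 r|lborel. f z) = 0"
proof -
  have T: "orthogonal_transformation (uminus :: real^'n::_ \<Rightarrow> _)"
    by (simp add: orthogonal_transformation_def linear_uminus)
  have "(LINT z:ball 0 r|lborel. f z) = (LINT z:ball 0 r|lborel. f (- z))"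
    by (rule set_integral_ball_orthogonal_transformation[OF T, symmetric]) simp
  also have "\<dots> = - (LINT z:ball 0 r|lborel. f z)"
    by (simp add: odd set_lebesgue_integral_def)
  finally show ?thesis
    by (metis add_cancel_right_left add.right_inverse double_zero real_vector.scale_minus_left scaleR_2 eq_neg_iff_add_eq_0 scale_eq_0_iff zero_neq_numeral)
qed

lemma set_integrable_ball_bounded:
  fixes f :: "'a::euclidean_space \<Rightarrow> 'b::{banach, second_countable_topology}"
  assumes "f \<in> borel_measurable borel" "\<And>z. z \<in> ball a r \<Longrightarrow> norm (f z) \<le> B"
  shows "set_integrable lborel (ball a r) f"
  unfolding set_integrable_def
  using assms by (intro integrableI_bounded_set_indicator[where B = B]) (auto simp: emeasure_lborel_ball_finite[unfolded infinity_ennreal_def])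

section \<open>The integral of the squared norm over a ball\<close>

text \<open>Integration by thin shells instead of polar coordinates: on the shell between the radii
  s and t the integrand lies between s^2 and t^2, and the volume of the shell is known. The
  candidate value satisfies the same two-sided bound, so the difference of the two functions of the
  radius has derivative zero, and it vanishes at radius 0.\<close>

lemma set_integral_norm2_ball:
  fixes r :: real
  assumes r: "0 \<le> r"
  shows "(LINT z:ball (0::real^3) r|lborel. (norm z)\<^sup>2) = 4 * pi * r ^ 5 / 5"
proof -
  define m where "m r = (LINT z:ball (0::real^3) r|lborel. (norm z)\<^sup>2)" for r
  define g where "g s = m s - 4 * pi * s ^ 5 / 5" for s
  have int: "set_integrable lborel (ball (0::real^3) s) (\<lambda>z. (norm z)\<^sup>2)" for s
    by (rule set_integrable_ball_bounded[where B = "s\<^sup>2"]) (auto intro: power_mono)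
  have intc: "set_integrable lborel (ball (0::real^3) s) (\<lambda>z. c::real)" for s c
    by (rule set_integrable_ball_bounded[where B = "\<bar>c\<bar>"]) auto
  have bounds: "s\<^sup>2 * (4/3 * pi * (t ^ 3 - s ^ 3)) \<le> m t - m s \<and> m t - m s \<le> t\<^sup>2 * (4/3 * pi * (t ^ 3 - s ^ 3))"
    if st: "0 \<le> s" "s \<le> t" for s t
  proof -
    let ?A = "ball (0::real^3) t - ball 0 s"
    have un: "ball 0 s \<union> ?A = ball (0::real^3) t" using st by auto
    have iA: "set_integrable lborel ?A (\<lambda>z. (norm z)\<^sup>2)"
      by (rule set_integrable_subset[OF int[of t]]) auto
    have icA: "set_integrable lborel ?A (\<lambda>z. c)" for c :: real
      by (rule set_integrable_subset[OF intc[of t]]) auto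
    have "m t = m s + (LINT z:?A|lborel. (norm z)\<^sup>2)"
    proof -
      have "(LINT z:ball 0 s \<union> ?A|lborel. (norm z)\<^sup>2) = m s + (LINT z:?A|lborel. (norm z)\<^sup>2)"
        unfolding m_def by (rule set_integral_Un[OF _ int iA]) auto
      then show ?thesis by (simp only: un m_def)
    qed
    moreover have "measure lborel ?A = 4/3 * pi * (t ^ 3 - s ^ 3)"
    proof -
      have "measure lborel ?A = measure lborel (ball (0::real^3) t) - measure lborel (ball (0::real^3) s)"
        by (rule measure_Diff) (use st emeasure_lborel_ball_finite[of "0::real^3" t] in auto)
      then show ?thesis using st by (simp add: content_ball unit_ball_vol_3 power3_eq_cube algebra_simps)
    qed
    moreover have "(LINT z:?A|lborel. c) = c * measure lborel ?A" for c :: real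
      by (simp add: set_lebesgue_integral_def mult.commute)
    moreover have "(LINT z:?A|lborel. s\<^sup>2) \<le> (LINT z:?A|lborel. (norm z)\<^sup>2)"
      by (rule set_integral_mono[OF icA iA]) (use st in \<open>auto intro!: power_mono\<close>)
    moreover have "(LINT z:?A|lborel. (norm z)\<^sup>2) \<le> (LINT z:?A|lborel. t\<^sup>2)"
      by (rule set_integral_mono[OF iA icA]) (use st in \<open>auto intro!: power_mono\<close>)
    ultimately show ?thesis by (simp only: add_diff_cancel_left')
  qed
  \<comment> \<open>The increments of both terms of \<open>g\<close> lie between \<open>s\<^sup>2\<close> and \<open>t\<^sup>2\<close> times the volume of the shell,
    so \<open>g\<close> has quadratically small increments and is constant.\<close>
  have g_le: "\<bar>g t - g s\<bar> \<le> (8 * pi * r ^ 3) * (t - s)\<^sup>2"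
    if st: "0 \<le> s" "s \<le> t" "t \<le> r" for s t
  proof -
    define V where "V = 4/3 * pi * (t ^ 3 - s ^ 3)"
    have t3: "t ^ 3 - s ^ 3 = (t - s) * (t\<^sup>2 + t * s + s\<^sup>2)"
      by algebra
    \<comment> \<open>These are the two shell bounds for the candidate 4 pi s^5 / 5 once the common
      factor \<open>4/15 * pi * (t - s)\<close> is taken out.\<close>
    have p1: "5 * (s\<^sup>2 * (t\<^sup>2 + t * s + s\<^sup>2)) \<le> 3 * (t^4 + t^3 * s + t\<^sup>2 * s\<^sup>2 + t * s^3 + s^4)"
      and p2: "3 * (t^4 + t^3 * s + t\<^sup>2 * s\<^sup>2 + t * s^3 + s^4) \<le> 5 * (t\<^sup>2 * (t\<^sup>2 + t * s + s\<^sup>2))"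
    proof -
      \<comment> \<open>In the variables s and d, both of them nonnegative, the difference of the
        two sides is a polynomial with nonnegative coefficients.\<close>
      define d where "d = t - s"
      have "t = s + d" "0 \<le> d" using st by (auto simp: d_def)
      then show "5 * (s\<^sup>2 * (t\<^sup>2 + t * s + s\<^sup>2)) \<le> 3 * (t^4 + t^3 * s + t\<^sup>2 * s\<^sup>2 + t * s^3 + s^4)"
        "3 * (t^4 + t^3 * s + t\<^sup>2 * s\<^sup>2 + t * s^3 + s^4) \<le> 5 * (t\<^sup>2 * (t\<^sup>2 + t * s + s\<^sup>2))"
        using st by (simp_all add: eval_nat_numeral algebra_simps add_nonneg_nonneg)
    qed
    have k: "0 \<le> 4/15 * pi * (t - s)" using st by simp
    have V: "x * V = 4/15 * pi * (t - s) * (5 * (x * (t\<^sup>2 + t * s + s\<^sup>2)))" for x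
      unfolding V_def t3 by (simp add: field_simps)
    have t5': "4 * pi * t ^ 5 / 5 - 4 * pi * s ^ 5 / 5 =
      4/15 * pi * (t - s) * (3 * (t^4 + t^3 * s + t\<^sup>2 * s\<^sup>2 + t * s^3 + s^4))"
      by algebra
    have q1: "s\<^sup>2 * V \<le> 4 * pi * t ^ 5 / 5 - 4 * pi * s ^ 5 / 5"
      unfolding t5' V by (rule mult_left_mono[OF p1 k])
    have q2: "4 * pi * t ^ 5 / 5 - 4 * pi * s ^ 5 / 5 \<le> t\<^sup>2 * V"
      unfolding t5' V by (rule mult_left_mono[OF p2 k])
    have "\<bar>g t - g s\<bar> \<le> t\<^sup>2 * V - s\<^sup>2 * V"
      using q1 q2 bounds[OF st(1,2)] by (auto simp: g_def V_def abs_le_iff)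
    also have "\<dots> = (4/3 * pi * ((t + s) * (t\<^sup>2 + t * s + s\<^sup>2))) * (t - s)\<^sup>2"
      unfolding V_def t3 by algebra
    \<comment> \<open>The difference t^2 - s^2 has supplied a second factor t - s; bounding s and t
      by r in what is left gives 4/3 pi * 2r * 3r^2 = 8 pi r^3.\<close>
    also have "\<dots> \<le> (4/3 * pi * ((r + r) * (r\<^sup>2 + r * r + r\<^sup>2))) * (t - s)\<^sup>2"
      using st by (intro mult_right_mono mult_left_mono mult_mono add_mono power_mono) auto
    also have "\<dots> = (8 * pi * r ^ 3) * (t - s)\<^sup>2" by algebra
    finally show ?thesis .
  qed
  have der: "(g has_field_derivative 0) (at x within {0..r})" if x: "x \<in> {0..r}" for x
    unfolding has_field_derivative_iff
  proof (rule Lim_null_comparison)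
    have "norm ((g y - g x) / (y - x)) \<le> (8 * pi * r ^ 3) * \<bar>y - x\<bar>" if y: "y \<in> {0..r}" "y \<noteq> x" for y
    proof -
      have "\<bar>g y - g x\<bar> \<le> (8 * pi * r ^ 3) * (y - x)\<^sup>2"
        using g_le[of x y] g_le[of y x] x y by (cases "x \<le> y") (auto simp: power2_commute abs_minus_commute)
      also have "\<dots> = (8 * pi * r ^ 3) * \<bar>y - x\<bar> * \<bar>y - x\<bar>"
        by (simp only: power2_abs[of "y - x", symmetric] power2_eq_square mult.assoc)
      finally show ?thesis using y
        by (simp only: real_norm_def abs_divide divide_le_eq) simp
    qed
    then show "\<forall>\<^sub>F y in at x within {0..r}. norm ((g y - g x) / (y - x)) \<le> (8 * pi * r ^ 3) * \<bar>y - x\<bar>"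
      by (auto simp: eventually_at_filter)
    show "((\<lambda>y. (8 * pi * r ^ 3) * \<bar>y - x\<bar>) \<longlongrightarrow> 0) (at x within {0..r})"
      by (rule tendsto_eq_intros refl | simp)+
  qed
  have "g r = g 0"
    using has_field_derivative_zero_constant[OF _ der] r by (metis atLeastAtMost_iff convex_real_interval(5) order_refl)
  moreover have "g 0 = 0" by (simp add: g_def m_def set_lebesgue_integral_def)
  ultimately show ?thesis by (simp add: g_def m_def)
qed

section \<open>The fourth moment tensor of the ball\<close>

text \<open>In the signed sum over all sign choices for b, c and d, a monomial survives if it is odd
  in each of the three. In degree four that leaves abcd, with coefficient 8 * 4! = 192.\<close>

lemma polarization4:
  fixes a b c d :: real
  shows "192 * (a * b * c * d) =
    (a + b + c + d)^4 - (a + b + c - d)^4 - (a + b - c + d)^4 + (a + b - c - d)^4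
    - (a - b + c + d)^4 + (a - b + c - d)^4 + (a - b - c + d)^4 - (a - b - c - d)^4"
  by algebra

text \<open>The fourth moment tensor is taken as a form in four arbitrary vectors rather than by
  coordinates, so that orthogonal maps and polarization act on its arguments directly.\<close>

definition quartic_moment :: "real \<Rightarrow> real^3 \<Rightarrow> real^3 \<Rightarrow> real^3 \<Rightarrow> real^3 \<Rightarrow> real" where
  "quartic_moment r a b c d =
    (LINT z:ball 0 r|lborel. (a \<bullet> z) * (b \<bullet> z) * (c \<bullet> z) * (d \<bullet> z) / (norm z)\<^sup>2)"

text \<open>Four applications of Cauchy-Schwarz bound the numerator by a multiple of |z|^4, so the
  quotient stays bounded near the origin.\<close>

lemma set_integrable_quartic:
  fixes a b c d :: "real^3"
  shows "set_integrable lborel (ball 0 r) (\<lambda>z. (a \<bullet> z) * (b \<bullet> z) * (c \<bullet> z) * (d \<bullet> z) / (norm z)\<^sup>2)"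
proof (rule set_integrable_ball_bounded)
  fix z :: "real^3"
  assume z: "z \<in> ball 0 r"
  have "\<bar>(a \<bullet> z) * (b \<bullet> z) * (c \<bullet> z) * (d \<bullet> z)\<bar>
      \<le> (norm a * norm z) * (norm b * norm z) * (norm c * norm z) * (norm d * norm z)"
    unfolding abs_mult by (intro mult_mono Cauchy_Schwarz_ineq2) auto
  also have "\<dots> = (norm a * norm b * norm c * norm d) * (norm z)\<^sup>2 * (norm z)\<^sup>2"
    by algebra
  finally have "norm ((a \<bullet> z) * (b \<bullet> z) * (c \<bullet> z) * (d \<bullet> z) / (norm z)\<^sup>2)
      \<le> (norm a * norm b * norm c * norm d) * (norm z)\<^sup>2"
    by (cases "z = 0") (simp_all add: divide_le_eq)
  also have "\<dots> \<le> (norm a * norm b * norm c * norm d) * r\<^sup>2"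
    using z by (intro mult_left_mono power_mono) auto
  finally show "norm ((a \<bullet> z) * (b \<bullet> z) * (c \<bullet> z) * (d \<bullet> z) / (norm z)\<^sup>2)
      \<le> (norm a * norm b * norm c * norm d) * r\<^sup>2" .
qed measurable

text \<open>An orthogonal map carries |u| times the first basis vector to u. Invariance of the
  integral and homogeneity of degree four reduce every u to that basis vector, whose own moment is
  the constant.\<close>

lemma quartic_moment_diagonal:
  obtains k where "\<And>u. quartic_moment r u u u u = k * (u \<bullet> u)\<^sup>2"
proof
  let ?e = "axis 1 1 :: real^3"
  fix u :: "real^3"
  have "norm (norm u *\<^sub>R ?e) = norm u" by simp
  then obtain T where T: "orthogonal_transformation T" and Tu: "T (norm u *\<^sub>R ?e) = u"
    by (rule orthogonal_transformation_exists)
  have "quartic_moment r u u u u =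
     (LINT z:ball 0 r|lborel. (u \<bullet> T z) * (u \<bullet> T z) * (u \<bullet> T z) * (u \<bullet> T z) / (norm (T z))\<^sup>2)"
    unfolding quartic_moment_def
    by (rule set_integral_ball_orthogonal_transformation[OF T, symmetric]) measurable
  also have "\<dots> = (LINT z:ball 0 r|lborel. (norm u)^4 * ((?e \<bullet> z) * (?e \<bullet> z) * (?e \<bullet> z) * (?e \<bullet> z) / (norm z)\<^sup>2))"
  proof (rule set_lebesgue_integral_cong; clarsimp)
    fix z
    have "u \<bullet> T z = T (norm u *\<^sub>R ?e) \<bullet> T z"
      by (simp only: Tu)
    also have "\<dots> = norm u * (?e \<bullet> z)"
      using T by (simp add: orthogonal_transformation_def)
    finally show "(u \<bullet> T z) * (u \<bullet> T z) * (u \<bullet> T z) * (u \<bullet> T z) / (norm (T z))\<^sup>2 =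
        (norm u)^4 * ((?e \<bullet> z) * (?e \<bullet> z) * (?e \<bullet> z) * (?e \<bullet> z)) / (norm z)\<^sup>2"
      by (simp add: orthogonal_transformation_norm[OF T] power4_eq_xxxx)
  qed
  also have "\<dots> = (norm u)^4 * quartic_moment r ?e ?e ?e ?e"
    unfolding quartic_moment_def by (rule set_integral_mult_right)
  finally show "quartic_moment r u u u u = quartic_moment r ?e ?e ?e ?e * (u \<bullet> u)\<^sup>2"
    by (simp add: power2_norm_eq_inner[symmetric])
qed

text \<open>A symmetric four-linear form is determined by its diagonal through polarization. The
  diagonal is a multiple of (u . u)^2, whose polarization is the isotropic tensor.\<close>

lemma quartic_moment_isotropic:
  obtains k where "\<And>a b c d. quartic_moment r a b c d =
    k * ((a \<bullet> b) * (c \<bullet> d) + (a \<bullet> c) * (b \<bullet> d) + (a \<bullet> d) * (b \<bullet> c))"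
proof -
  obtain k where k: "\<And>u. quartic_moment r u u u u = k * (u \<bullet> u)\<^sup>2"
    using quartic_moment_diagonal[of r] by blast
  show thesis
  proof (rule that)
    fix a b c d :: "real^3"
    define F where "F u z = (u \<bullet> z) * (u \<bullet> z) * (u \<bullet> z) * (u \<bullet> z) / (norm z)\<^sup>2" for u z :: "real^3"
    have I: "set_integrable lborel (ball 0 r) (F u)" for u
      unfolding F_def by (rule set_integrable_quartic)
    have F: "(LINT z:ball 0 r|lborel. F u z) = k * (u \<bullet> u)\<^sup>2" for u
      using k[of u] by (simp only: quartic_moment_def F_def)
    have "192 * quartic_moment r a b c d =
      (LINT z:ball 0 r|lborel. 192 * ((a \<bullet> z) * (b \<bullet> z) * (c \<bullet> z) * (d \<bullet> z) / (norm z)\<^sup>2))"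
      unfolding quartic_moment_def by (rule set_integral_mult_right[symmetric])
    also have "\<dots> = (LINT z:ball 0 r|lborel.
        F (a + b + c + d) z - F (a + b + c - d) z - F (a + b - c + d) z + F (a + b - c - d) z
        - F (a - b + c + d) z + F (a - b + c - d) z + F (a - b - c + d) z - F (a - b - c - d) z)"
    proof (rule set_lebesgue_integral_cong; clarsimp)
      fix z
      show "192 * ((a \<bullet> z) * (b \<bullet> z) * (c \<bullet> z) * (d \<bullet> z)) / (norm z)\<^sup>2 =
        F (a + b + c + d) z - F (a + b + c - d) z - F (a + b - c + d) z + F (a + b - c - d) z
        - F (a - b + c + d) z + F (a - b + c - d) z + F (a - b - c + d) z - F (a - b - c - d) z"
        by (simp only: F_def polarization4 inner_add_left inner_diff_left diff_divide_distrib add_divide_distrib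
            power4_eq_xxxx)
    qed
    also have "\<dots> = k * (((a + b + c + d) \<bullet> (a + b + c + d))\<^sup>2 - ((a + b + c - d) \<bullet> (a + b + c - d))\<^sup>2
      - ((a + b - c + d) \<bullet> (a + b - c + d))\<^sup>2 + ((a + b - c - d) \<bullet> (a + b - c - d))\<^sup>2
      - ((a - b + c + d) \<bullet> (a - b + c + d))\<^sup>2 + ((a - b + c - d) \<bullet> (a - b + c - d))\<^sup>2
      + ((a - b - c + d) \<bullet> (a - b - c + d))\<^sup>2 - ((a - b - c - d) \<bullet> (a - b - c - d))\<^sup>2)"
      by (subst set_integral_add set_integral_diff; (intro set_integral_add set_integral_diff I)?)+
         (simp only: F right_diff_distrib distrib_left)
    \<comment> \<open>The polarization of (u . u)^2 is the average of the three pairings; hence the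
      constant of the tensor is a third of the diagonal constant.\<close>
    also have "\<dots> = 192 * (k / 3 * ((a \<bullet> b) * (c \<bullet> d) + (a \<bullet> c) * (b \<bullet> d) + (a \<bullet> d) * (b \<bullet> c)))"
      unfolding inner_add_left inner_diff_left inner_add_right inner_diff_right
        inner_commute[of b a] inner_commute[of c a] inner_commute[of d a]
        inner_commute[of c b] inner_commute[of d b] inner_commute[of d c]
      by algebra
    finally show "quartic_moment r a b c d =
      k / 3 * ((a \<bullet> b) * (c \<bullet> d) + (a \<bullet> c) * (b \<bullet> d) + (a \<bullet> d) * (b \<bullet> c))" by simp
  qed
qed

text \<open>Contraction of the tensor in its first two slots: the integrand is multiplied by (z_1^2
  + z_2^2 + z_3^2) / |z|^2, which is 1 away from the origin.\<close>

lemma set_integral_ball_quadratic_eq_quartic: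
  fixes a b :: "real^3"
  shows "(LINT z:ball 0 r|lborel. (a \<bullet> z) * (b \<bullet> z)) =
    quartic_moment r (axis 1 1) (axis 1 1) a b + quartic_moment r (axis 2 1) (axis 2 1) a b
    + quartic_moment r (axis 3 1) (axis 3 1) a b"
proof -
  let ?f = "\<lambda>i z::real^3. (axis i 1 \<bullet> z) * (axis i 1 \<bullet> z) * (a \<bullet> z) * (b \<bullet> z) / (norm z)\<^sup>2"
  have "(LINT z:ball 0 r|lborel. (a \<bullet> z) * (b \<bullet> z)) = (LINT z:ball 0 r|lborel. ?f 1 z + ?f 2 z + ?f 3 z)"
  proof (rule set_lebesgue_integral_cong; clarsimp)
    fix z :: "real^3"
    have "(norm z)\<^sup>2 = z $ 1 * z $ 1 + z $ 2 * z $ 2 + z $ 3 * z $ 3"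
      by (simp add: power2_norm_eq_inner inner_vec_def sum_3)
    then have "?f 1 z + ?f 2 z + ?f 3 z = (norm z)\<^sup>2 * ((a \<bullet> z) * (b \<bullet> z)) / (norm z)\<^sup>2"
      by (simp add: inner_axis' add_divide_distrib[symmetric] algebra_simps)
    then show "(a \<bullet> z) * (b \<bullet> z) = ?f 1 z + ?f 2 z + ?f 3 z"
      \<comment> \<open>At the origin the quotients are 0 by the convention for division, and the
        left side is 0 as well.\<close>
      by (cases "z = 0") auto
  qed
  also have "\<dots> = quartic_moment r (axis 1 1) (axis 1 1) a b + quartic_moment r (axis 2 1) (axis 2 1) a b
    + quartic_moment r (axis 3 1) (axis 3 1) a b"
    unfolding quartic_moment_def by (subst set_integral_add; (intro set_integral_add set_integrable_quartic)?)+ simp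
  finally show ?thesis .
qed

lemma inner_axis_axis_3:
  "(axis 1 1 :: real^3) \<bullet> axis 1 1 = 1" "(axis 2 1 :: real^3) \<bullet> axis 2 1 = 1"
  "(axis 3 1 :: real^3) \<bullet> axis 3 1 = 1"
  by (simp_all add: inner_axis_axis)

text \<open>One constant k is left to find. Contracting the isotropic tensor once gives (3 + 2) k
  times the inner product, contracting again gives 15 k, and this must be the integral of |z|^2,
  that is 4 pi r^5 / 5.\<close>

lemma ball_moments:
  fixes a b c d :: "real^3"
  assumes r: "0 \<le> r"
  shows quartic_moment_eq: "quartic_moment r a b c d =
      4 * pi * r ^ 5 / 75 * ((a \<bullet> b) * (c \<bullet> d) + (a \<bullet> c) * (b \<bullet> d) + (a \<bullet> d) * (b \<bullet> c))"
    and quadratic_moment_eq: "(LINT z:ball 0 r|lborel. (a \<bullet> z) * (b \<bullet> z)) = 4 * pi * r ^ 5 / 15 * (a \<bullet> b)"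
proof -
  obtain k where k: "\<And>a b c d. quartic_moment r a b c d =
    k * ((a \<bullet> b) * (c \<bullet> d) + (a \<bullet> c) * (b \<bullet> d) + (a \<bullet> d) * (b \<bullet> c))"
    using quartic_moment_isotropic[of r] by blast
  have q: "(LINT z:ball 0 r|lborel. (a \<bullet> z) * (b \<bullet> z)) = 5 * k * (a \<bullet> b)" for a b :: "real^3"
    unfolding set_integral_ball_quadratic_eq_quartic k
    by (simp add: inner_axis_axis_3 inner_axis inner_axis' inner_vec_def[of a b] sum_3 algebra_simps)
  let ?g = "\<lambda>i z::real^3. (axis i 1 \<bullet> z) * (axis i 1 \<bullet> z)"
  have int: "set_integrable lborel (ball 0 r) (?g i)" for i
  proof (rule set_integrable_ball_bounded)
    fix z :: "real^3" assume "z \<in> ball 0 r"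
    then have "\<bar>z $ i\<bar> \<le> r" using component_le_norm_cart[of z i] by simp
    then have "\<bar>z $ i\<bar> * \<bar>z $ i\<bar> \<le> r * r" by (intro mult_mono) auto
    then show "norm (?g i z) \<le> r * r" by (simp add: inner_axis' abs_mult)
  qed measurable
  have "4 * pi * r ^ 5 / 5 = (LINT z:ball (0::real^3) r|lborel. (norm z)\<^sup>2)"
    using set_integral_norm2_ball[OF r] by simp
  also have "\<dots> = (LINT z:ball 0 r|lborel. ?g 1 z + ?g 2 z + ?g 3 z)"
  proof -
    have "(norm z)\<^sup>2 = ?g 1 z + ?g 2 z + ?g 3 z" for z
      by (simp add: inner_axis' power2_norm_eq_inner inner_vec_def[of z z] sum_3)
    then show ?thesis by simp
  qed
  also have "\<dots> = (LINT z:ball 0 r|lborel. ?g 1 z) + (LINT z:ball 0 r|lborel. ?g 2 z)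
      + (LINT z:ball 0 r|lborel. ?g 3 z)"
    by (subst set_integral_add; (intro set_integral_add int)?)+ simp
  also have "\<dots> = 15 * k"
    unfolding q inner_axis_axis_3 by simp
  finally have k_eq: "k = 4 * pi * r ^ 5 / 75" by simp
  show "quartic_moment r a b c d =
      4 * pi * r ^ 5 / 75 * ((a \<bullet> b) * (c \<bullet> d) + (a \<bullet> c) * (b \<bullet> d) + (a \<bullet> d) * (b \<bullet> c))"
    unfolding k k_eq ..
  show "(LINT z:ball 0 r|lborel. (a \<bullet> z) * (b \<bullet> z)) = 4 * pi * r ^ 5 / 15 * (a \<bullet> b)"
    unfolding q k_eq by simp
qed

subsection \<open>Second derivatives and Taylor expansion\<close>

text \<open>Mean value inequality for curves. It is applied below to functions from which the
  expected main term has been subtracted.\<close>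

lemma norm_diff_le_vector_derivative_bound:
  fixes g :: "real \<Rightarrow> 'b::real_normed_vector"
  assumes ab: "a \<le> b"
    and g: "\<And>t. a \<le> t \<Longrightarrow> t \<le> b \<Longrightarrow> (g has_vector_derivative g' t) (at t)"
    and B: "\<And>t. a \<le> t \<Longrightarrow> t \<le> b \<Longrightarrow> norm (g' t) \<le> B"
  shows "norm (g b - g a) \<le> B * (b - a)"
proof -
  have "norm (g b - g a) \<le> B * norm (b - a)"
  proof (rule differentiable_bound[of "{a..b}" g "\<lambda>t s. s *\<^sub>R g' t"])
    fix t assume t: "t \<in> {a..b}"
    then show "(g has_derivative (\<lambda>s. s *\<^sub>R g' t)) (at t within {a..b})"
      using g[of t] by (auto simp: has_vector_derivative_def intro: has_derivative_at_withinI)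
    show "onorm (\<lambda>s. s *\<^sub>R g' t) \<le> B"
      using B[of t] t by (intro onorm_le) (auto simp: mult.commute[of B] intro!: mult_left_mono)
  qed (use ab in auto)
  then show ?thesis using ab by simp
qed

lemma has_vector_derivative_along_line:
  assumes "(w has_derivative blinfun_apply D) (at (p + t *\<^sub>R u))"
  shows "((\<lambda>s. w (p + s *\<^sub>R u)) has_vector_derivative blinfun_apply D u) (at t)"
proof -
  have "((\<lambda>s. p + s *\<^sub>R u) has_derivative (\<lambda>s. s *\<^sub>R u)) (at t)"
    by (auto intro!: derivative_eq_intros)
  from has_derivative_compose[OF this assms] show ?thesis
    by (simp add: has_vector_derivative_def blinfun.scaleR_right)
qed

text \<open>For a fixed step h v, the increment of w is followed in the direction u. Its derivative
  is the difference of \<open>w'\<close> at two points near x, applied to u, and the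
  differentiability of \<open>w'\<close> at x turns this into h \<open>H v u\<close> up to a small
  error, which the mean value inequality integrates.\<close>

lemma second_difference_approx:
  fixes w :: "'a::real_normed_vector \<Rightarrow> 'b::real_normed_vector"
    and w' :: "'a \<Rightarrow> 'a \<Rightarrow>\<^sub>L 'b"
  assumes w: "\<And>y. (w has_derivative blinfun_apply (w' y)) (at y)"
    and H: "(w' has_derivative blinfun_apply H) (at x)"
    and e: "0 < e"
  obtains d where "0 < d" "\<And>h. 0 \<le> h \<Longrightarrow> h < d \<Longrightarrow>
    norm (w (x + h *\<^sub>R u + h *\<^sub>R v) - w (x + h *\<^sub>R u) - w (x + h *\<^sub>R v) + w x - h\<^sup>2 *\<^sub>R H v u) \<le> e * h\<^sup>2"
proof -
  define n where "n = norm u + norm v + 1"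
  have n: "1 \<le> n" "norm u \<le> n" "norm u + norm v \<le> n" by (auto simp: n_def)
  \<comment> \<open>Two remainders occur, each at most \<open>e' * (h * n) * n\<close>, and together
    they must not exceed \<open>e * h\<close>.\<close>
  define e' where "e' = e / (2 * n * n)"
  have e': "0 < e'" using e n by (simp add: e'_def)
  then obtain d where d: "0 < d"
    "\<And>y. norm (y - x) < d \<Longrightarrow> norm (w' y - w' x - H (y - x)) \<le> e' * norm (y - x)"
    using H unfolding has_derivative_at_alt by blast
  show thesis
  proof (rule that)
    show "0 < d / n" using d n by simp
    fix h assume h: "0 \<le> h" "h < d / n"
    \<comment> \<open>The second difference is the increment of \<open>g\<close> over \<open>{0..h}\<close>, up to the subtracted linear term.\<close>
    define g where "g t = w (x + h *\<^sub>R v + t *\<^sub>R u) - w (x + t *\<^sub>R u) - t *\<^sub>R (h *\<^sub>R H v u)" for t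
    have "norm (g h - g 0) \<le> (e * h) * (h - 0)"
    proof (rule norm_diff_le_vector_derivative_bound)
      fix t assume t: "0 \<le> t" "t \<le> h"
      let ?p = "h *\<^sub>R v + t *\<^sub>R u" and ?q = "t *\<^sub>R u"
      show "(g has_vector_derivative w' (x + h *\<^sub>R v + t *\<^sub>R u) u - w' (x + t *\<^sub>R u) u - h *\<^sub>R H v u) (at t)"
        unfolding g_def
        by (rule derivative_eq_intros has_vector_derivative_along_line w refl | simp)+
      have hn: "h * n < d" using h n by (simp add: field_simps)
      have "norm ?p \<le> h * norm v + h * norm u"
        using t h by (intro order_trans[OF norm_triangle_ineq] add_mono) (auto intro: mult_right_mono)
      also have "\<dots> = h * (norm u + norm v)" by (simp add: algebra_simps)
      also have "\<dots> \<le> h * n" using h n by (intro mult_left_mono) auto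
      finally have p: "norm ?p \<le> h * n" .
      have "norm ?q \<le> h * norm u" using t by (simp add: mult_right_mono)
      also have "\<dots> \<le> h * n" using h n by (intro mult_left_mono) auto
      finally have q: "norm ?q \<le> h * n" .
      have P: "norm (w' (x + ?p) - w' x - H ?p) \<le> e' * (h * n)"
        using d(2)[of "x + ?p"] p hn e' by (simp, smt (verit) mult_left_mono)
      have Q: "norm (w' (x + ?q) - w' x - H ?q) \<le> e' * (h * n)"
        using d(2)[of "x + ?q"] q hn e' by (simp, smt (verit) mult_left_mono)
      \<comment> \<open>Since \<open>?p\<close> and \<open>?q\<close> differ by exactly h v, the
        values of \<open>H\<close> at them differ by h \<open>H v\<close>, which cancels the
        subtracted term.\<close>
      have "w' (x + h *\<^sub>R v + t *\<^sub>R u) u - w' (x + t *\<^sub>R u) u - h *\<^sub>R H v u =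
          (w' (x + ?p) - w' x - H ?p) u - (w' (x + ?q) - w' x - H ?q) u"
        by (simp add: blinfun.diff_left blinfun.add_left blinfun.add_right blinfun.scaleR_right
            blinfun.scaleR_left add.assoc)
      also have "norm \<dots> \<le> e' * (h * n) * norm u + e' * (h * n) * norm u"
        by (rule order_trans[OF norm_triangle_ineq4 add_mono];
            rule order_trans[OF norm_blinfun mult_right_mono]) (use P Q in auto)
      also have "\<dots> \<le> e' * (h * n) * n + e' * (h * n) * n"
        using n h e' by (intro add_mono mult_left_mono) auto
      also have "\<dots> = e * h" using n by (simp add: e'_def field_simps)
      finally show "norm (w' (x + h *\<^sub>R v + t *\<^sub>R u) u - w' (x + t *\<^sub>R u) u - h *\<^sub>R H v u) \<le> e * h" .
    qed (use h in auto)
    moreover have "g h - g 0 = w (x + h *\<^sub>R u + h *\<^sub>R v) - w (x + h *\<^sub>R u) - w (x + h *\<^sub>R v) + w x - h\<^sup>2 *\<^sub>R H v u"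
      by (simp add: g_def power2_eq_square algebra_simps)
    ultimately show "norm (w (x + h *\<^sub>R u + h *\<^sub>R v) - w (x + h *\<^sub>R u) - w (x + h *\<^sub>R v) + w x - h\<^sup>2 *\<^sub>R H v u) \<le> e * h\<^sup>2"
      by (simp add: power2_eq_square mult.assoc)
  qed
qed

text \<open>The second difference does not change when u and v are exchanged, yet divided by h^2 it
  approximates both \<open>H v u\<close> and \<open>H u v\<close>.\<close>

lemma second_derivative_symmetric:
  fixes w :: "'a::real_normed_vector \<Rightarrow> 'b::real_normed_vector"
    and w' :: "'a \<Rightarrow> 'a \<Rightarrow>\<^sub>L 'b"
  assumes w: "\<And>y. (w has_derivative blinfun_apply (w' y)) (at y)"
    and H: "(w' has_derivative blinfun_apply H) (at x)"
  shows "H u v = H v u"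
proof -
  have "norm (H u v - H v u) \<le> e" if e: "0 < e" for e
  proof -
    have e2: "0 < e / 2" using e by simp
    obtain d1 where d1: "0 < d1" "\<And>h. 0 \<le> h \<Longrightarrow> h < d1 \<Longrightarrow>
      norm (w (x + h *\<^sub>R u + h *\<^sub>R v) - w (x + h *\<^sub>R u) - w (x + h *\<^sub>R v) + w x - h\<^sup>2 *\<^sub>R H v u) \<le> e / 2 * h\<^sup>2"
      using second_difference_approx[OF w H e2, of u v] by blast
    obtain d2 where d2: "0 < d2" "\<And>h. 0 \<le> h \<Longrightarrow> h < d2 \<Longrightarrow>
      norm (w (x + h *\<^sub>R v + h *\<^sub>R u) - w (x + h *\<^sub>R v) - w (x + h *\<^sub>R u) + w x - h\<^sup>2 *\<^sub>R H u v) \<le> e / 2 * h\<^sup>2"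
      using second_difference_approx[OF w H e2, of v u] by blast
    define h where "h = min d1 d2 / 2"
    have h: "0 < h" "h < d1" "h < d2" using d1 d2 by (auto simp: h_def)
    let ?D = "w (x + h *\<^sub>R u + h *\<^sub>R v) - w (x + h *\<^sub>R u) - w (x + h *\<^sub>R v) + w x"
    have "h\<^sup>2 *\<^sub>R (H u v - H v u) = (?D - h\<^sup>2 *\<^sub>R H v u) - (?D - h\<^sup>2 *\<^sub>R H u v)"
      by (simp add: algebra_simps)
    also have "norm \<dots> \<le> e / 2 * h\<^sup>2 + e / 2 * h\<^sup>2"
    proof (rule order_trans[OF norm_triangle_ineq4 add_mono])
      show "norm (?D - h\<^sup>2 *\<^sub>R H v u) \<le> e / 2 * h\<^sup>2"
        using d1(2)[of h] h by simp
      have eq: "?D = w (x + h *\<^sub>R v + h *\<^sub>R u) - w (x + h *\<^sub>R v) - w (x + h *\<^sub>R u) + w x"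
        by (simp add: algebra_simps)
      show "norm (?D - h\<^sup>2 *\<^sub>R H u v) \<le> e / 2 * h\<^sup>2"
        unfolding eq by (rule d2(2)) (use h in auto)
    qed
    finally have "h\<^sup>2 * norm (H u v - H v u) \<le> h\<^sup>2 * e" by (simp add: mult.commute)
    then show ?thesis using h by simp
  qed
  then have "norm (H u v - H v u) \<le> 0" by (rule field_le_epsilon[of _ 0, simplified])
  then show ?thesis by simp
qed

text \<open>Along the segment from x to x + h, w minus its quadratic Taylor polynomial has as
  derivative the first-order remainder of \<open>w'\<close> at x, applied to h. This is at most e
  |h|^2, and the mean value inequality on the unit interval finishes.\<close>

lemma second_order_Taylor:
  fixes w :: "'a::real_normed_vector \<Rightarrow> 'b::real_normed_vector"
    and w' :: "'a \<Rightarrow> 'a \<Rightarrow>\<^sub>L 'b"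
  assumes w: "\<And>y. (w has_derivative blinfun_apply (w' y)) (at y)"
    and H: "(w' has_derivative blinfun_apply H) (at x)"
    and e: "0 < e"
  obtains d where "0 < d" "\<And>h. norm h < d \<Longrightarrow>
    norm (w (x + h) - w x - w' x h - (1/2) *\<^sub>R H h h) \<le> e * (norm h)\<^sup>2"
proof -
  obtain d where d: "0 < d"
    "\<And>y. norm (y - x) < d \<Longrightarrow> norm (w' y - w' x - H (y - x)) \<le> e * norm (y - x)"
    using H e unfolding has_derivative_at_alt by blast
  show thesis
  proof (rule that[OF d(1)])
    fix h :: 'a assume h: "norm h < d"
    define g where "g t = w (x + t *\<^sub>R h) - t *\<^sub>R w' x h - (t\<^sup>2 / 2) *\<^sub>R H h h" for t :: real
    have "norm (g 1 - g 0) \<le> (e * (norm h)\<^sup>2) * (1 - 0)"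
    proof (rule norm_diff_le_vector_derivative_bound)
      fix t :: real assume t: "0 \<le> t" "t \<le> 1"
      show "(g has_vector_derivative w' (x + t *\<^sub>R h) h - w' x h - t *\<^sub>R H h h) (at t)"
        unfolding g_def
        by (rule derivative_eq_intros has_vector_derivative_along_line w refl | simp)+
      have th: "t * norm h \<le> norm h" using t by (simp add: mult_left_le_one_le)
      have "norm (w' (x + t *\<^sub>R h) - w' x - H (t *\<^sub>R h)) \<le> e * (t * norm h)"
        using d(2)[of "x + t *\<^sub>R h"] th h t by simp
      also have "\<dots> \<le> e * norm h" using th e by simp
      finally have "norm ((w' (x + t *\<^sub>R h) - w' x - H (t *\<^sub>R h)) h) \<le> e * norm h * norm h"
        by (intro order_trans[OF norm_blinfun] mult_right_mono) auto
      then show "norm (w' (x + t *\<^sub>R h) h - w' x h - t *\<^sub>R H h h) \<le> e * (norm h)\<^sup>2"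
        by (simp add: blinfun.diff_left blinfun.scaleR_left blinfun.scaleR_right power2_eq_square mult.assoc)
    qed auto
    then show "norm (w (x + h) - w x - w' x h - (1/2) *\<^sub>R H h h) \<le> e * (norm h)\<^sup>2"
      by (simp add: g_def algebra_simps)
  qed
qed

section \<open>Partial derivatives and the curl of the curl\<close>

lemma partial_deriv_eq:
  assumes "(f has_derivative D) (at x)"
  shows "partial_deriv j f x = D (axis j 1)"
proof -
  interpret D: bounded_linear D using assms by (rule has_derivative_bounded_linear)
  have "((\<lambda>t. x + t *\<^sub>R axis j 1) has_derivative (\<lambda>t. t *\<^sub>R axis j 1)) (at 0)"
    by (auto intro!: derivative_eq_intros)
  from has_derivative_compose[OF this, of f D] assms
  have "((\<lambda>t. f (x + t *\<^sub>R axis j 1)) has_field_derivative D (axis j 1)) (at 0)"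
    by (simp add: has_field_derivative_def D.scaleR mult_commute_abs)
  then show ?thesis unfolding partial_deriv_def by (rule DERIV_imp_deriv)
qed

lemma partial_deriv_component:
  assumes "\<And>y. (w has_derivative blinfun_apply (w' y)) (at y)"
  shows "partial_deriv j (\<lambda>y. w y $ i) = (\<lambda>y. w' y (axis j 1) $ i)"
proof
  fix y
  have "((\<lambda>y. w y $ i) has_derivative (\<lambda>h. w' y h $ i)) (at y)"
    using bounded_linear.has_derivative[OF bounded_linear_vec_nth assms] .
  then show "partial_deriv j (\<lambda>y. w y $ i) y = w' y (axis j 1) $ i"
    by (rule partial_deriv_eq)
qed

lemma has_derivative_component_along:
  fixes w' :: "real^3 \<Rightarrow> (real^3) \<Rightarrow>\<^sub>L (real^3)"
  assumes "(w' has_derivative blinfun_apply H) (at x)"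
  shows "((\<lambda>y. w' y v $ i) has_derivative (\<lambda>h. H h v $ i)) (at x)"
  using bounded_linear.has_derivative[OF bounded_linear_vec_nth
      bounded_linear.has_derivative[OF blinfun.bounded_linear_left assms]] .

text \<open>The classical identity curl curl w = grad div w - Lap w makes the difference grad div w
  - 2 Lap w. Here \<open>H (axis k 1) (axis l 1) $ j\<close> is the partial derivative of w_j in the
  directions k and l; symmetry of \<open>H\<close> exchanges mixed derivatives.\<close>

lemma curl_curl_minus_laplacian_component:
  fixes w :: "real^3 \<Rightarrow> real^3" and w' :: "real^3 \<Rightarrow> (real^3) \<Rightarrow>\<^sub>L (real^3)"
  assumes w: "\<And>y. (w has_derivative blinfun_apply (w' y)) (at y)"
    and H: "(w' has_derivative blinfun_apply H) (at x)"
  shows "(curl (curl w) x - vector_laplacian w x) $ i =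
    (\<Sum>j\<in>UNIV. H (axis i 1) (axis j 1) $ j) - 2 * (\<Sum>k\<in>UNIV. H (axis k 1) (axis k 1) $ i)"
proof -
  note P = partial_deriv_component[OF w]
  note S = second_derivative_symmetric[OF w H]
  note D = has_derivative_component_along[OF H]
  have D2: "partial_deriv k (\<lambda>y. w' y v $ j) x = H (axis k 1) v $ j" for k j v
    by (rule partial_deriv_eq[OF D])
  have D3: "partial_deriv k (\<lambda>y. w' y v $ j - w' y u $ l) x = H (axis k 1) v $ j - H (axis k 1) u $ l"
    for k j l u v
    by (rule partial_deriv_eq[OF has_derivative_diff[OF D D]])
  show ?thesis
    using exhaust_3[of i]
    by (auto simp: curl_def vector_laplacian_def laplacian_def P D2 D3 sum_3
        S[of "axis 1 1" "axis 2 1"] S[of "axis 1 1" "axis 3 1"] S[of "axis 2 1" "axis 3 1"])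
qed

subsection \<open>The nonlocal operator\<close>

text \<open>For nonzero z this is minus the orthogonal projection of d onto the plane perpendicular
  to z; for z = 0 it is 0.\<close>

definition double_cross :: "real^3 \<Rightarrow> real^3 \<Rightarrow> real^3" where
  "double_cross z d = (z /\<^sub>R norm z) \<times> ((z /\<^sub>R norm z) \<times> d)"

lemma linear_double_cross: "linear (double_cross z)"
  by (rule linearI) (simp_all add: double_cross_def cross_add_right cross_mult_right)

lemmas double_cross_0 = linear_0[OF linear_double_cross]
  and double_cross_neg = linear_neg[OF linear_double_cross]
  and double_cross_diff = linear_diff[OF linear_double_cross]
  and double_cross_scaleR = linear_scale[OF linear_double_cross]

lemma double_cross_minus_left: "double_cross (- z) d = double_cross z d"
  by (simp add: double_cross_def)

text \<open>Lagrange's identity n \<times> (n \<times> d) = (n . d) n - d for a unit vector n. For d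
  quadratic in z, the first term leads to fourth moments and the second to quadratic ones.\<close>

lemma double_cross_component:
  assumes "z \<noteq> 0"
  shows "double_cross z d $ i = z $ i * (z \<bullet> d) / (norm z)\<^sup>2 - d $ i"
  using assms unfolding double_cross_def Lagrange
  by (simp add: power2_norm_eq_inner[symmetric] power2_eq_square field_simps)

lemma norm_cross_le:
  fixes a b :: "real^3"
  shows "norm (a \<times> b) \<le> norm a * norm b"
proof (rule power2_le_imp_le)
  show "(norm (a \<times> b))\<^sup>2 \<le> (norm a * norm b)\<^sup>2"
    unfolding norm_cross_dot[of a b, symmetric] by simp
qed simp

lemma norm_double_cross_le: "norm (double_cross z d) \<le> norm d"
proof -
  let ?n = "z /\<^sub>R norm z"
  have n: "norm ?n \<le> 1" by (cases "z = 0") auto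
  have "norm (double_cross z d) \<le> norm ?n * (norm ?n * norm d)"
    unfolding double_cross_def
    by (intro order_trans[OF norm_cross_le] mult_left_mono norm_cross_le) auto
  also have "\<dots> \<le> 1 * (1 * norm d)"
    using n by (intro mult_mono) auto
  finally show ?thesis by simp
qed

text \<open>The cross product is continuous in the pair of its arguments, while z / |z| is
  discontinuous at 0 but still Borel.\<close>

lemma borel_measurable_double_cross [measurable (raw)]:
  assumes [measurable]: "g \<in> borel_measurable M" "f \<in> borel_measurable M"
  shows "(\<lambda>z. double_cross (g z) (f z)) \<in> borel_measurable M"
proof -
  have cross: "(\<lambda>z. a z \<times> b z) \<in> borel_measurable M"
    if "a \<in> borel_measurable M" "b \<in> borel_measurable M" for a b :: "'a \<Rightarrow> real^3"
    by (rule borel_measurable_continuous_Pair[OF that])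
      (intro continuous_on_cross continuous_intros)
  have "(\<lambda>z. g z /\<^sub>R norm (g z)) \<in> borel_measurable M" by measurable
  then show ?thesis unfolding double_cross_def by (intro cross) auto
qed

lemma set_integrable_double_cross:
  assumes f: "continuous_on UNIV f"
  shows "set_integrable lborel (ball 0 r) (\<lambda>z. double_cross z (f z))"
proof -
  have "bounded (f ` cball 0 r)"
    by (intro compact_imp_bounded compact_continuous_image continuous_on_subset[OF f]) auto
  then obtain B where B: "\<And>z. z \<in> cball 0 r \<Longrightarrow> norm (f z) \<le> B"
    unfolding bounded_iff by blast
  have "f \<in> borel_measurable borel" using f by (rule borel_measurable_continuous_onI)
  then have "(\<lambda>z. double_cross z (f z)) \<in> borel_measurable borel" by measurable
  then show ?thesis
    by (rule set_integrable_ball_bounded[where B = B])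
      (use B in \<open>force intro: order_trans[OF norm_double_cross_le]\<close>)
qed

section \<open>The integral of the quadratic Taylor term\<close>

lemma set_integral_sum_finite:
  fixes f :: "'i \<Rightarrow> 'a \<Rightarrow> 'b::{banach, second_countable_topology}"
  assumes "\<And>i. i \<in> I \<Longrightarrow> set_integrable M A (f i)"
  shows "(LINT x:A|M. (\<Sum>i\<in>I. f i x)) = (\<Sum>i\<in>I. LINT x:A|M. f i x)"
  using assms unfolding set_lebesgue_integral_def set_integrable_def
  by (simp add: scaleR_sum_right)

lemma set_integrable_sum_finite:
  fixes f :: "'i \<Rightarrow> 'a \<Rightarrow> 'b::{banach, second_countable_topology}"
  assumes "\<And>i. i \<in> I \<Longrightarrow> set_integrable M A (f i)"
  shows "set_integrable M A (\<lambda>x. \<Sum>i\<in>I. f i x)"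
  using assms unfolding set_integrable_def
  by (simp add: scaleR_sum_right)

lemma blinfun_quadratic_expansion:
  fixes H :: "(real^'n) \<Rightarrow>\<^sub>L ((real^'n) \<Rightarrow>\<^sub>L (real^'m))"
  shows "H z z $ j = (\<Sum>k\<in>UNIV. \<Sum>l\<in>UNIV. H (axis k 1) (axis l 1) $ j * (z $ k * z $ l))"
proof -
  have z: "(\<Sum>k\<in>UNIV. z $ k *\<^sub>R axis k 1) = z"
    using basis_expansion[of z] by (simp add: scalar_mult_eq_scaleR)
  have inner: "B z $ j = (\<Sum>l\<in>UNIV. z $ l * (B (axis l 1) $ j))" for B :: "(real^'n) \<Rightarrow>\<^sub>L (real^'m)"
    by (subst z[symmetric]) (simp add: blinfun.sum_right blinfun.scaleR_right)
  have "H z v $ j = (\<Sum>k\<in>UNIV. z $ k * (H (axis k 1) v $ j))" for v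
    by (subst z[symmetric])
      (simp add: blinfun.sum_right blinfun.sum_left blinfun.scaleR_right blinfun.scaleR_left)
  then have "H z z $ j = (\<Sum>k\<in>UNIV. z $ k * (H (axis k 1) z $ j))" .
  also have "\<dots> = (\<Sum>k\<in>UNIV. z $ k * (\<Sum>l\<in>UNIV. z $ l * (H (axis k 1) (axis l 1) $ j)))"
    by (simp only: inner)
  also have "\<dots> = (\<Sum>k\<in>UNIV. \<Sum>l\<in>UNIV. H (axis k 1) (axis l 1) $ j * (z $ k * z $ l))"
    by (simp add: sum_distrib_left mult_ac)
  finally show ?thesis .
qed

text \<open>In units of 4 pi r^5 / 75, the three pairings of the fourth moment give one Laplacian
  term and, by symmetry of \<open>H\<close>, twice the gradient of the divergence; the quadratic
  moment subtracts five Laplacian terms. What remains is 2 grad div - 4 Lap.\<close>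

lemma set_integral_double_cross_quadratic:
  fixes H :: "(real^3) \<Rightarrow>\<^sub>L ((real^3) \<Rightarrow>\<^sub>L (real^3))"
  assumes r: "0 \<le> r" and sym: "\<And>u v. H u v = H v u"
  shows "(LINT z:ball 0 r|lborel. double_cross z (H z z)) $ i = 8 * pi * r ^ 5 / 75 *
    ((\<Sum>j\<in>UNIV. H (axis i 1) (axis j 1) $ j) - 2 * (\<Sum>k\<in>UNIV. H (axis k 1) (axis k 1) $ i))"
proof -
  let ?e = "\<lambda>k. axis k 1 :: real^3"
  let ?M = "\<lambda>k l j. H (?e k) (?e l) $ j"
  let ?q = "\<lambda>j k l z. (?e i \<bullet> z) * (?e j \<bullet> z) * (?e k \<bullet> z) * (?e l \<bullet> z) / (norm z)\<^sup>2"
  let ?p = "\<lambda>k l z. (?e k \<bullet> z) * (?e l \<bullet> z)"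
  have qi: "set_integrable lborel (ball 0 r) (\<lambda>z. ?M k l j * ?q j k l z)" for j k l
    by (intro set_integrable_mult_right set_integrable_quartic)
  have pi: "set_integrable lborel (ball 0 r) (\<lambda>z. ?M k l i * ?p k l z)" for k l
  proof (intro set_integrable_mult_right set_integrable_ball_bounded)
    fix z :: "real^3" assume "z \<in> ball 0 r"
    then have "\<bar>z $ k\<bar> \<le> r" "\<bar>z $ l\<bar> \<le> r"
      using component_le_norm_cart[of z k] component_le_norm_cart[of z l] by simp_all
    then have "\<bar>z $ k\<bar> * \<bar>z $ l\<bar> \<le> r * r" using r by (intro mult_mono) auto
    then show "norm (?p k l z) \<le> r * r" by (simp add: inner_axis' abs_mult)
  qed measurable
  have cont: "continuous_on UNIV (\<lambda>z. H z z)"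
    by (intro continuous_intros)
  have "(LINT z:ball 0 r|lborel. double_cross z (H z z)) $ i
      = (LINT z:ball 0 r|lborel. double_cross z (H z z) $ i)"
    using integral_bounded_linear[OF bounded_linear_vec_nth[of i]
        set_integrable_double_cross[OF cont, of r, unfolded set_integrable_def]]
    by (simp add: set_lebesgue_integral_def)
  also have "\<dots> = (LINT z:ball 0 r|lborel.
      (\<Sum>j\<in>UNIV. \<Sum>k\<in>UNIV. \<Sum>l\<in>UNIV. ?M k l j * ?q j k l z) - (\<Sum>k\<in>UNIV. \<Sum>l\<in>UNIV. ?M k l i * ?p k l z))"
  proof (rule set_lebesgue_integral_cong; clarsimp)
    fix z :: "real^3"
    show "double_cross z (H z z) $ i = (\<Sum>j\<in>UNIV. \<Sum>k\<in>UNIV. \<Sum>l\<in>UNIV.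
      ?M k l j * ((?e i \<bullet> z) * (?e j \<bullet> z) * (?e k \<bullet> z) * (?e l \<bullet> z)) / (norm z)\<^sup>2)
      - (\<Sum>k\<in>UNIV. \<Sum>l\<in>UNIV. ?M k l i * ?p k l z)"
    proof (cases "z = 0")
      case True
      then show ?thesis by (simp add: double_cross_0)
    next
      case False
      have "z $ i * (z \<bullet> H z z) / (norm z)\<^sup>2 =
        (\<Sum>j\<in>UNIV. \<Sum>k\<in>UNIV. \<Sum>l\<in>UNIV. ?M k l j * (z $ i * z $ j * z $ k * z $ l) / (norm z)\<^sup>2)"
        unfolding inner_vec_def blinfun_quadratic_expansion
        by (simp add: sum_distrib_left sum_divide_distrib mult_ac)
      then show ?thesis
        unfolding double_cross_component[OF False] by (simp add: blinfun_quadratic_expansion inner_axis')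
    qed
  qed
  also have "\<dots> = (\<Sum>j\<in>UNIV. \<Sum>k\<in>UNIV. \<Sum>l\<in>UNIV. ?M k l j * quartic_moment r (?e i) (?e j) (?e k) (?e l))
      - (\<Sum>k\<in>UNIV. \<Sum>l\<in>UNIV. ?M k l i * (LINT z:ball 0 r|lborel. ?p k l z))"
    by (simp only: set_integral_diff set_integral_sum_finite set_integrable_sum_finite qi pi
        set_integral_mult_right quartic_moment_def)
  also have "\<dots> = 8 * pi * r ^ 5 / 75 *
    ((\<Sum>j\<in>UNIV. ?M i j j) - 2 * (\<Sum>k\<in>UNIV. ?M k k i))"
    using exhaust_3[of i] sym[of "?e 1" "?e 2"] sym[of "?e 1" "?e 3"] sym[of "?e 2" "?e 3"]
    unfolding quartic_moment_eq[OF r] quadratic_moment_eq[OF r]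
    by (auto simp: sum_3 inner_axis_axis field_simps)
  finally show ?thesis .
qed

section \<open>The nonlocal operator as a ball integral, and its limit\<close>

text \<open>Exchanging x and y flips the sign of both the kernel and the increment of w, so the two
  terms of the symmetrized function coincide; this is the factor 2. A translation then centres the
  ball at the origin.\<close>

lemma nonlocal_curl_ball_kernel:
  assumes w: "continuous_on UNIV w"
  shows "nonlocal_curl (ball_kernel \<delta>) (nonlocal_curl_adj (ball_kernel \<delta>) w) x =
    2 *\<^sub>R (LINT z:ball 0 \<delta>|lborel. double_cross z (w (x + z) - w x))"
proof -
  let ?\<alpha> = "ball_kernel \<delta>"
  let ?f = "\<lambda>z. indicat_real (ball 0 \<delta>) z *\<^sub>R (2 *\<^sub>R double_cross z (w (x + z) - w x))"
  have "?\<alpha> x y \<times> (?\<alpha> x y \<times> (w y - w x) + ?\<alpha> y x \<times> (w x - w y)) = ?f (y - x)" for y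
  proof -
    have "?\<alpha> y x \<times> (w x - w y) = ?\<alpha> x y \<times> (w y - w x)"
      unfolding ball_kernel_antisym[of \<delta> y x] by (metis cross_minus_left cross_minus_right minus_diff_eq)
    then have "?\<alpha> x y \<times> (?\<alpha> x y \<times> (w y - w x) + ?\<alpha> y x \<times> (w x - w y)) =
      2 *\<^sub>R (?\<alpha> x y \<times> (?\<alpha> x y \<times> (w y - w x)))"
      by (simp only: cross_add_right scaleR_2)
    also have "\<dots> = ?f (y - x)"
      by (cases "y \<in> ball x \<delta>")
        (simp_all add: ball_kernel_def double_cross_def dist_norm norm_minus_commute)
    finally show ?thesis .
  qed
  then have "nonlocal_curl ?\<alpha> (nonlocal_curl_adj ?\<alpha> w) x = (LINT y|lborel. ?f (y - x))"
    by (simp add: nonlocal_curl_def nonlocal_curl_adj_def)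
  \<comment> \<open>Translation invariance of Lebesgue measure, prepared for the substitution y = x
    + z.\<close>
  also have "\<dots> = (LINT y|distr lborel borel ((+) x). ?f (y - x))"
    by (simp only: lborel_distr_plus)
  also have "\<dots> = (LINT z|lborel. ?f (x + z - x))"
  proof (rule integral_distr)
    have "(\<lambda>z. w (x + z) - w x) \<in> borel_measurable borel"
      by (intro borel_measurable_continuous_onI continuous_intros continuous_on_compose2[OF w]) auto
    then have "?f \<in> borel_measurable borel"
      by (intro borel_measurable_scaleR borel_measurable_indicator borel_measurable_double_cross) auto
    then show "(\<lambda>y. ?f (y - x)) \<in> borel_measurable borel"
      by (rule measurable_compose[rotated]) measurable
  qed simp
  also have "\<dots> = 2 *\<^sub>R (LINT z:ball 0 \<delta>|lborel. double_cross z (w (x + z) - w x))"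
    unfolding set_integral_scaleR_right[symmetric] unfolding set_lebesgue_integral_def
    by (simp only: add_diff_cancel_left')
  finally show ?thesis .
qed

text \<open>For every small radius the linear Taylor term contributes exactly 0 and the quadratic
  term exactly the limit, so what has to be estimated is the Taylor remainder.\<close>

lemma nonlocal_curl_ball_kernel_tendsto:
  fixes w :: "real^3 \<Rightarrow> real^3" and w' :: "real^3 \<Rightarrow> (real^3) \<Rightarrow>\<^sub>L (real^3)"
  assumes w: "\<And>y. (w has_derivative blinfun_apply (w' y)) (at y)"
    and H: "(w' has_derivative blinfun_apply H) (at x)"
  shows "((\<lambda>\<delta>. kappa \<delta> *\<^sub>R nonlocal_curl (ball_kernel \<delta>) (nonlocal_curl_adj (ball_kernel \<delta>) w) x)
    \<longlongrightarrow> curl (curl w) x - vector_laplacian w x) (at_right 0)"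
proof (rule tendstoI)
  fix e0 :: real assume e0: "0 < e0"
  \<comment> \<open>The final error bound is 2 \<open>kappa \<delta>\<close> e times 4 pi \<delta>^5
    / 5, which is 15 e, that is half of \<open>e0\<close>.\<close>
  define e where "e = e0 / 30"
  have e: "0 < e" using e0 by (simp add: e_def)
  have sym: "H u v = H v u" for u v by (rule second_derivative_symmetric[OF w H])
  have cw: "continuous_on UNIV w"
    by (meson w has_derivative_continuous continuous_at_imp_continuous_on)
  define d where "d z = w (x + z) - w x" for z
  have cd: "continuous_on UNIV d"
    unfolding d_def by (intro continuous_intros continuous_on_compose2[OF cw]) auto
  have cL: "continuous_on UNIV (\<lambda>z. w' x z)" and cH: "continuous_on UNIV (\<lambda>z. H z z)"
    by (intro continuous_intros)+
  obtain \<eta> where \<eta>: "0 < \<eta>" and Taylor: "\<And>z. norm z < \<eta> \<Longrightarrow>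
      norm (w (x + z) - w x - w' x z - (1/2) *\<^sub>R H z z) \<le> e * (norm z)\<^sup>2"
    using second_order_Taylor[OF w H e] by blast
  have "dist (kappa \<delta> *\<^sub>R nonlocal_curl (ball_kernel \<delta>) (nonlocal_curl_adj (ball_kernel \<delta>) w) x)
      (curl (curl w) x - vector_laplacian w x) < e0" if \<delta>: "0 < \<delta>" "\<delta> < \<eta>" for \<delta>
  proof -
    let ?I = "\<lambda>f. LINT z:ball 0 \<delta>|lborel. f z"
    let ?Q = "?I (\<lambda>z. double_cross z (H z z))"
    let ?R = "\<lambda>z. double_cross z (d z) - double_cross z (w' x z) - (1/2) *\<^sub>R double_cross z (H z z)"
    note int = set_integrable_double_cross[OF cd] set_integrable_double_cross[OF cL]
      set_integrable_double_cross[OF cH]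
    have intR: "set_integrable lborel (ball 0 \<delta>) ?R"
      by (intro set_integral_diff set_integrable_scaleR_right int)
    \<comment> \<open>The factor 2 of the nonlocal operator and the 1/2 of the Taylor expansion
      cancel, so \<open>?Q\<close> enters with weight \<open>kappa \<delta>\<close>, the reciprocal
      of 8 pi \<delta>^5 / 75.\<close>
    have target: "kappa \<delta> *\<^sub>R ?Q = curl (curl w) x - vector_laplacian w x"
    proof (rule vec_eq_iff[THEN iffD2], rule allI)
      fix i
      show "(kappa \<delta> *\<^sub>R ?Q) $ i = (curl (curl w) x - vector_laplacian w x) $ i"
        using \<delta> unfolding vector_scaleR_component set_integral_double_cross_quadratic[OF less_imp_le[OF \<delta>(1)] sym]
          curl_curl_minus_laplacian_component[OF w H]
        by (simp add: kappa_def)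
    qed
    \<comment> \<open>\<open>double_cross\<close> is even in its first argument and linear in its
      second, so the integrand is odd.\<close>
    have odd: "?I (\<lambda>z. double_cross z (w' x z)) = 0"
    proof (rule set_integral_ball_odd)
      show "(\<lambda>z. double_cross z (w' x z)) \<in> borel_measurable borel"
        using borel_measurable_continuous_onI[OF cL] by measurable
    qed (simp add: double_cross_minus_left blinfun.minus_right double_cross_neg)
    have "?I ?R = ?I (\<lambda>z. double_cross z (d z)) - (1/2) *\<^sub>R ?Q"
      using odd by (simp add: set_integral_diff int set_integrable_scaleR_right)
    then have "kappa \<delta> *\<^sub>R nonlocal_curl (ball_kernel \<delta>) (nonlocal_curl_adj (ball_kernel \<delta>) w) x
        - (curl (curl w) x - vector_laplacian w x) = (2 * kappa \<delta>) *\<^sub>R ?I ?R"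
      unfolding nonlocal_curl_ball_kernel[OF cw] target[symmetric] d_def[symmetric]
      by (simp add: scaleR_diff_right mult.commute)
    moreover have "norm (?I ?R) \<le> e * (4 * pi * \<delta> ^ 5 / 5)"
    proof -
      have "norm (?I ?R) \<le> ?I (\<lambda>z. norm (?R z))"
        by (rule set_integral_norm_bound[OF intR])
      also have "\<dots> \<le> ?I (\<lambda>z::real^3. e * (norm z)\<^sup>2)"
      proof (rule set_integral_mono)
        show "set_integrable lborel (ball 0 \<delta>) (\<lambda>z. norm (?R z))"
          by (rule set_integrable_norm[OF intR])
        show "set_integrable lborel (ball 0 \<delta>) (\<lambda>z::real^3. e * (norm z)\<^sup>2)"
          by (rule set_integrable_mult_right, rule set_integrable_ball_bounded[where B = "\<delta>\<^sup>2"])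
            (auto intro: power_mono)
        fix z :: "real^3" assume "z \<in> ball 0 \<delta>"
        then have "norm z < \<eta>" using \<delta> by simp
        \<comment> \<open>Linearity in the second argument collects the three terms into the double
          cross product of the Taylor remainder, whose norm is not increased.\<close>
        have Rz: "?R z = double_cross z (w (x + z) - w x - w' x z - (1/2) *\<^sub>R H z z)"
          by (simp only: double_cross_diff double_cross_scaleR d_def)
        show "norm (?R z) \<le> e * (norm z)\<^sup>2"
          unfolding Rz by (rule order_trans[OF norm_double_cross_le Taylor[OF \<open>norm z < \<eta>\<close>]])
      qed
      also have "\<dots> = e * (4 * pi * \<delta> ^ 5 / 5)"
        using \<delta> by (simp add: set_integral_norm2_ball)
      finally show ?thesis .
    qed
    ultimately have "dist (kappa \<delta> *\<^sub>R nonlocal_curl (ball_kernel \<delta>) (nonlocal_curl_adj (ball_kernel \<delta>) w) x)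
        (curl (curl w) x - vector_laplacian w x) \<le> \<bar>2 * kappa \<delta>\<bar> * (e * (4 * pi * \<delta> ^ 5 / 5))"
      by (simp only: dist_norm norm_scaleR mult_left_mono abs_ge_zero)
    also have "\<dots> = 15 * e"
      using \<delta> by (simp add: kappa_def field_simps)
    also have "\<dots> < e0" using e0 by (simp add: e_def)
    finally show ?thesis .
  qed
  then show "\<forall>\<^sub>F \<delta> in at_right 0. dist (kappa \<delta> *\<^sub>R nonlocal_curl (ball_kernel \<delta>)
      (nonlocal_curl_adj (ball_kernel \<delta>) w) x) (curl (curl w) x - vector_laplacian w x) < e0"
    unfolding eventually_at_right_field using \<eta> by blast
qed

theorem mainTheorem3:
  fixes w :: "real^3 \<Rightarrow> real^3"
  assumes "C2 w"
  shows "(\<forall>x. ((\<lambda>\<delta>. kappa \<delta> *\<^sub>R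
              nonlocal_curl (ball_kernel \<delta>) (nonlocal_curl_adj (ball_kernel \<delta>) w) x)
            \<longlongrightarrow> curl (curl w) x - vector_laplacian w x) (at_right 0)) \<and>
         ((\<forall>x. ((\<lambda>\<delta>. kappa \<delta> *\<^sub>R
              nonlocal_curl (ball_kernel \<delta>) (nonlocal_curl_adj (ball_kernel \<delta>) w) x)
            \<longlongrightarrow> curl (curl w) x) (at_right 0))
          \<longleftrightarrow> harmonic w)"
proof -
  let ?L = "\<lambda>x \<delta>. kappa \<delta> *\<^sub>R nonlocal_curl (ball_kernel \<delta>) (nonlocal_curl_adj (ball_kernel \<delta>) w) x"
  have lim: "(?L x \<longlongrightarrow> curl (curl w) x - vector_laplacian w x) (at_right 0)" for x
    using assms nonlocal_curl_ball_kernel_tendsto unfolding C2_def by blast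
  \<comment> \<open>Limits along the nontrivial filter \<open>at_right 0\<close> are unique, so the
    limit is the curl of the curl exactly at the points where the vector Laplacian vanishes.\<close>
  have "(?L x \<longlongrightarrow> curl (curl w) x) (at_right 0) \<longleftrightarrow> vector_laplacian w x = 0" for x
    using tendsto_unique[OF trivial_limit_at_right_real lim, of x "curl (curl w) x"] lim[of x] by auto
  with lim assms show ?thesis by (simp add: harmonic_def)
qed

end
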